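(* Let $D$ be an integral domain with quotient field $F$. (1) For any star operation $*$ on $D$, there exists a unique smallest semistar operation $s( * )$ on $D$ such that $s( * )|_{\mathcal{F}(D)} = *$, and for all $I \in \mathcal{K}(D)$ one has $$I^{s( * )} = \bigcap \{K \in \mathcal{K}(D) : K \supseteq I \text{ and } \forall J \in \mathcal{F}(D)\ (J \subseteq K \Rightarrow J^* \subseteq K)\}.$$ (2) More generally, for any nucleus $\gamma$ on a submonoid $\mathcal{M}$ of $\mathcal{K}(D)$ containing $\operatorname{Prin}(D)$, there exists a unique smallest semistar operation $\star$ on $D$ such that $\star|_{\mathcal{M}} = \gamma$, and for all $I \in \mathcal{K}(D)$ one has $$I^\star = \bigcap \{K \in \mathcal{K}(D) : K \supseteq I \text{ and } \forall J \in \mathcal{M}\ (J \subseteq K \Rightarrow J^\gamma \subseteq K)\}.$$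
   Context: $\mathcal{K}(D)$ is the set of all nonzero $D$-submodules of $F$, ordered by inclusion and with the usual product of $D$-submodules (an ordered monoid). $\mathcal{F}(D)\subseteq\mathcal{K}(D)$ is the submonoid of nonzero fractional ideals, i.e. nonzero $D$-submodules $I$ of $F$ with $aI\subseteq D$ for some nonzero $a\in F$. $\operatorname{Prin}(D)$ is the submonoid of all nonzero principal (cyclic) $D$-submodules $aD$, $a\in F\setminus\{0\}$. A closure operation on a poset is a self-map $\star: x\mapsto x^\star$ that is expansive, order-preserving and idempotent. A nucleus on an ordered monoid $M$ is a closure operation $\star$ on $M$ with $x^\star y^\star\le(xy)^\star$ for all $x,y\in M$. A semistar operation on $D$ is a closure operation $\star$ on $\mathcal{K}(D)$ with $(aI)^\star = aI^\star$ for all nonzero $a\in F$ and all $I\in\mathcal{K}(D)$. A star operation on $D$ is a closure operation $*$ on $\mathcal{F}(D)$ with $D^*=D$ and $(aI)^* = aI^*$ for all nonzero $a\in F$ and all $I\in\mathcal{F}(D)$. Semistar operations are ordered pointwise by inclusion. $\star|_{\mathcal M}=\gamma$ means $I^\star = I^\gamma$ for all $I\in\mathcal{M}$. *)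

theory Defs
  imports
    "HOL-Computational_Algebra.Polynomial_Factorial"
    "HOL-Algebra.Group"
    "HOL-Library.FuncSet"
begin

text \<open>
  The integral domain \<open>D\<close> is a type \<open>'a :: idom\<close>, its quotient field \<open>F\<close> is the library type
  \<open>'a fract\<close>, and \<open>D\<close> is identified with the range of the embedding \<open>to_fract\<close>.  The
  \<open>D\<close>-submodules of \<open>F\<close> are the subspaces of \<open>F\<close> as a \<open>D\<close>-module in the sense of \<open>HOL.Modules\<close>.
\<close>

definition fract_scale :: "'a::idom \<Rightarrow> 'a fract \<Rightarrow> 'a fract" where
  "fract_scale d x = to_fract d * x"

interpretation fract_module: module fract_scale
  by unfold_locales (simp_all add: fract_scale_def algebra_simps)

definition base_domain :: "'a::idom fract set" where
  "base_domain = range to_fract"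

definition dilate :: "'a::idom fract \<Rightarrow> 'a fract set \<Rightarrow> 'a fract set" where
  "dilate a I = (\<lambda>x. a * x) ` I"

definition nonzero_submodules :: "'a::idom fract set set" where
  "nonzero_submodules = {I. fract_module.subspace I \<and> I \<noteq> {0}}"

definition fractional_ideals :: "'a::idom fract set set" where
  "fractional_ideals =
     {I \<in> nonzero_submodules. \<exists>a. a \<noteq> 0 \<and> dilate a I \<subseteq> base_domain}"

definition principal_submodules :: "'a::idom fract set set" where
  "principal_submodules = {dilate a base_domain | a. a \<noteq> 0}"

definition submodule_product :: "'a::idom fract set \<Rightarrow> 'a fract set \<Rightarrow> 'a fract set" where
  "submodule_product I J = fract_module.span {x * y | x y. x \<in> I \<and> y \<in> J}"

definition submodule_monoid :: "'a::idom fract set monoid" where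
  "submodule_monoid =
     \<lparr>carrier = nonzero_submodules, mult = submodule_product, one = base_domain\<rparr>"

text \<open>
  A self-map of a subset \<open>P\<close> of an ordered type is an element of \<open>P \<rightarrow>\<^sub>E P\<close>: its value outside
  \<open>P\<close> is the fixed dummy \<open>undefined\<close>.  Hence two self-maps of \<open>P\<close> are equal as HOL functions
  exactly if they agree on \<open>P\<close>, so uniqueness can be stated with plain equality.
\<close>

definition closure_operation_on :: "'p::order set \<Rightarrow> ('p \<Rightarrow> 'p) \<Rightarrow> bool" where
  "closure_operation_on P c \<longleftrightarrow>
     c \<in> P \<rightarrow>\<^sub>E P \<and>
     (\<forall>x\<in>P. x \<le> c x) \<and>
     mono_on P c \<and>
     (\<forall>x\<in>P. c (c x) = c x)"

text \<open>The order of the ordered monoid \<open>M\<close> is that of the underlying type (inclusion, for sets).\<close>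

definition nucleus :: "('p::order, 'z) monoid_scheme \<Rightarrow> ('p \<Rightarrow> 'p) \<Rightarrow> bool" where
  "nucleus M c \<longleftrightarrow>
     closure_operation_on (carrier M) c \<and>
     (\<forall>x\<in>carrier M. \<forall>y\<in>carrier M. c x \<otimes>\<^bsub>M\<^esub> c y \<le> c (x \<otimes>\<^bsub>M\<^esub> y))"

definition semistar_operation :: "('a::idom fract set \<Rightarrow> 'a fract set) \<Rightarrow> bool" where
  "semistar_operation s \<longleftrightarrow>
     closure_operation_on nonzero_submodules s \<and>
     (\<forall>a I. a \<noteq> 0 \<longrightarrow> I \<in> nonzero_submodules \<longrightarrow> s (dilate a I) = dilate a (s I))"

definition star_operation :: "('a::idom fract set \<Rightarrow> 'a fract set) \<Rightarrow> bool" where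
  "star_operation s \<longleftrightarrow>
     closure_operation_on fractional_ideals s \<and>
     s base_domain = base_domain \<and>
     (\<forall>a I. a \<noteq> 0 \<longrightarrow> I \<in> fractional_ideals \<longrightarrow> s (dilate a I) = dilate a (s I))"

definition semistar_extension ::
  "'a::idom fract set set \<Rightarrow> ('a fract set \<Rightarrow> 'a fract set) \<Rightarrow>
   ('a fract set \<Rightarrow> 'a fract set) \<Rightarrow> bool" where
  "semistar_extension \<M> c s \<longleftrightarrow> semistar_operation s \<and> (\<forall>I\<in>\<M>. s I = c I)"

definition smallest_semistar_extension ::
  "'a::idom fract set set \<Rightarrow> ('a fract set \<Rightarrow> 'a fract set) \<Rightarrow>
   ('a fract set \<Rightarrow> 'a fract set) \<Rightarrow> bool" where
  "smallest_semistar_extension \<M> c s \<longleftrightarrow>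
     semistar_extension \<M> c s \<and>
     (\<forall>t. semistar_extension \<M> c t \<longrightarrow> (\<forall>I\<in>nonzero_submodules. s I \<subseteq> t I))"

end

theory Submission
  imports Defs
begin

text \<open>
  Call \<open>K\<close> closed if \<open>J \<subseteq> K\<close> implies \<open>\<gamma> J \<subseteq> K\<close> for all \<open>J \<in> \<M>\<close>.  Closed submodules are stable
  under intersection, so the smallest closed submodule containing \<open>I\<close> defines a closure operation.
  It restricts to \<open>\<gamma>\<close> because \<open>\<gamma> I\<close> is itself closed, it is minimal because every value of an
  extension of \<open>\<gamma>\<close> is closed, and it commutes with dilations because these permute the closed
  submodules.  A nucleus on a monoid containing the principal submodules commutes with
  dilations since \<open>a I = (a D) I\<close>, which reduces both parts to this construction.
\<close>

section \<open>Dilation of submodules by nonzero field elements\<close>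

lemma dilate_dilate: "dilate a (dilate b I) = dilate (a * b) I"
  by (simp add: dilate_def image_image mult.assoc)

lemma dilate_one [simp]: "dilate 1 I = I"
  by (simp add: dilate_def)

lemma dilate_mono: "I \<subseteq> J \<Longrightarrow> dilate a I \<subseteq> dilate a J"
  unfolding dilate_def by (rule image_mono)

lemma dilate_inverse_cancel [simp]:
  assumes "a \<noteq> 0"
  shows "dilate a (dilate (inverse a) I) = I" "dilate (inverse a) (dilate a I) = I"
  using assms by (simp_all add: dilate_dilate)

text \<open>For nonzero \<open>a\<close>, dilation is an order automorphism with inverse
  \<open>dilate (inverse a)\<close>; this form moves the factor across an inclusion.\<close>

lemma dilate_subset_iff:
  assumes "a \<noteq> 0"
  shows "dilate a I \<subseteq> J \<longleftrightarrow> I \<subseteq> dilate (inverse a) J"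
  using dilate_mono[of "dilate a I" J "inverse a"] dilate_mono[of I "dilate (inverse a) J" a] assms
  by auto

lemma subspace_dilate:
  assumes "fract_module.subspace I"
  shows "fract_module.subspace (dilate a I)"
proof (rule fract_module.subspaceI)
  show "0 \<in> dilate a I"
    using fract_module.subspace_0[OF assms] by (force simp: dilate_def)
next
  fix x y assume "x \<in> dilate a I" "y \<in> dilate a I"
  then show "x + y \<in> dilate a I"
    using fract_module.subspace_add[OF assms] by (force simp: dilate_def distrib_left[symmetric])
next
  fix d x assume "x \<in> dilate a I"
  then obtain z where z: "z \<in> I" "x = a * z" by (auto simp: dilate_def)
  then have "fract_scale d x = a * fract_scale d z" by (simp add: fract_scale_def mult_ac)
  with z fract_module.subspace_scale[OF assms] show "fract_scale d x \<in> dilate a I"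
    by (auto simp: dilate_def)
qed

lemma dilate_nonzero_submodule:
  assumes "a \<noteq> 0" "I \<in> nonzero_submodules"
  shows "dilate a I \<in> nonzero_submodules"
proof -
  have "dilate a I \<noteq> {0}"
  proof
    assume "dilate a I = {0}"
    then have "dilate (inverse a) (dilate a I) = {0}" by (simp add: dilate_def)
    with assms show False by (simp add: nonzero_submodules_def)
  qed
  with assms show ?thesis by (simp add: nonzero_submodules_def subspace_dilate)
qed

lemma dilate_fractional_ideal:
  assumes "a \<noteq> 0" "I \<in> fractional_ideals"
  shows "dilate a I \<in> fractional_ideals"
proof -
  from assms(2) obtain b where b: "b \<noteq> 0" "dilate b I \<subseteq> base_domain"
    by (auto simp: fractional_ideals_def)
  \<comment> \<open>If \<open>b\<close> clears the denominators of \<open>I\<close>, then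
    \<open>b * inverse a\<close> clears those of \<open>dilate a I\<close>.\<close>
  have "dilate (b * inverse a) (dilate a I) \<subseteq> base_domain"
    using assms b by (simp add: dilate_dilate mult.assoc)
  moreover have "b * inverse a \<noteq> 0" using assms b by simp
  ultimately show ?thesis
    using assms dilate_nonzero_submodule unfolding fractional_ideals_def by blast
qed

text \<open>The common lower bound \<open>I\<close> keeps the intersection from being zero. For an
  empty family the intersection is all of the quotient field.\<close>

lemma Inter_nonzero_submodules:
  assumes "\<And>K. K \<in> \<K> \<Longrightarrow> K \<in> nonzero_submodules \<and> I \<subseteq> K" "I \<in> nonzero_submodules"
  shows "\<Inter>\<K> \<in> nonzero_submodules"
proof -
  have "fract_module.subspace (\<Inter>\<K>)"
    using assms by (intro fract_module.subspace_Inter) (auto simp: nonzero_submodules_def)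
  moreover have "\<Inter>\<K> \<noteq> {0}"
  proof
    assume "\<Inter>\<K> = {0}"
    moreover have "I \<subseteq> \<Inter>\<K>" using assms(1) by (intro Inter_greatest) simp
    moreover have "0 \<in> I" "I \<noteq> {0}"
      using assms(2) fract_module.subspace_0 by (auto simp: nonzero_submodules_def)
    ultimately show False by auto
  qed
  ultimately show ?thesis by (simp add: nonzero_submodules_def)
qed

text \<open>The reverse inclusion follows by applying the hypothesis to \<open>inverse a\<close>.\<close>

lemma dilate_equivariantI:
  assumes "\<And>a I. a \<noteq> 0 \<Longrightarrow> I \<in> P \<Longrightarrow> dilate a I \<in> P"
    and "\<And>a I. a \<noteq> 0 \<Longrightarrow> I \<in> P \<Longrightarrow> dilate a (c I) \<subseteq> c (dilate a I)"
    and "a \<noteq> 0" "I \<in> P"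
  shows "c (dilate a I) = dilate a (c I)"
proof (rule antisym)
  have "dilate (inverse a) (c (dilate a I)) \<subseteq> c (dilate (inverse a) (dilate a I))"
    using assms(1,3,4) by (intro assms(2)) simp_all
  then show "c (dilate a I) \<subseteq> dilate a (c I)"
    using assms(3) by (simp add: dilate_subset_iff)
qed (rule assms(2)[OF assms(3,4)])

section \<open>Closed submodules and the closure operation they define\<close>

definition closed_submodules ::
  "'a::idom fract set set \<Rightarrow> ('a fract set \<Rightarrow> 'a fract set) \<Rightarrow> 'a fract set set" where
  "closed_submodules \<M> c = {K \<in> nonzero_submodules. \<forall>J\<in>\<M>. J \<subseteq> K \<longrightarrow> c J \<subseteq> K}"

text \<open>The restricted abstraction makes the map extensional, as
  \<open>closure_operation_on\<close> demands, so that it can be equal as a function to a smallest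
  extension.\<close>

definition closed_hull ::
  "'a::idom fract set set \<Rightarrow> ('a fract set \<Rightarrow> 'a fract set) \<Rightarrow> 'a fract set \<Rightarrow> 'a fract set" where
  "closed_hull \<M> c =
     (\<lambda>I\<in>nonzero_submodules. \<Inter>{K \<in> closed_submodules \<M> c. I \<subseteq> K})"

lemma closed_hull_eq:
  "I \<in> nonzero_submodules \<Longrightarrow>
     closed_hull \<M> c I = \<Inter>{K \<in> closed_submodules \<M> c. I \<subseteq> K}"
  by (simp add: closed_hull_def)

lemma closed_hull_subset:
  assumes "K \<in> closed_submodules \<M> c" "I \<in> nonzero_submodules" "I \<subseteq> K"
  shows "closed_hull \<M> c I \<subseteq> K"
  using assms by (auto simp: closed_hull_eq)

lemma closed_hull_in_closed_submodules:
  assumes "I \<in> nonzero_submodules"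
  shows "closed_hull \<M> c I \<in> closed_submodules \<M> c"
proof -
  have "closed_hull \<M> c I \<in> nonzero_submodules"
    unfolding closed_hull_eq[OF assms]
    by (rule Inter_nonzero_submodules[OF _ assms]) (auto simp: closed_submodules_def)
  moreover have "c J \<subseteq> closed_hull \<M> c I" if "J \<in> \<M>" "J \<subseteq> closed_hull \<M> c I" for J
    unfolding closed_hull_eq[OF assms]
  proof (rule Inter_greatest)
    fix K assume K: "K \<in> {K \<in> closed_submodules \<M> c. I \<subseteq> K}"
    then have "J \<subseteq> K" using that(2) unfolding closed_hull_eq[OF assms] by blast
    with K that(1) show "c J \<subseteq> K" by (simp add: closed_submodules_def)
  qed
  ultimately show ?thesis by (simp add: closed_submodules_def)
qed

lemma subset_closed_hull: "I \<in> nonzero_submodules \<Longrightarrow> I \<subseteq> closed_hull \<M> c I"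
  by (auto simp: closed_hull_eq)

lemma closure_operation_closed_hull:
  fixes c :: "'a::idom fract set \<Rightarrow> 'a fract set"
  shows "closure_operation_on nonzero_submodules (closed_hull \<M> c)"
proof -
  let ?h = "closed_hull \<M> c"
  have sub: "?h I \<in> nonzero_submodules" if "I \<in> nonzero_submodules" for I
    using closed_hull_in_closed_submodules[OF that] by (auto simp: closed_submodules_def)
  have "?h \<in> nonzero_submodules \<rightarrow>\<^sub>E nonzero_submodules"
    using sub by (auto simp: closed_hull_def)
  moreover have "mono_on nonzero_submodules ?h"
  proof (rule mono_onI)
    fix I J :: "'a fract set"
    assume IJ: "I \<in> nonzero_submodules" "J \<in> nonzero_submodules" "I \<subseteq> J"
    \<comment> \<open>The hull of \<open>J\<close> is a closed submodule above \<open>I\<close>,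
      hence above the hull of \<open>I\<close>.\<close>
    have "I \<subseteq> ?h J" by (rule order_trans[OF IJ(3) subset_closed_hull[OF IJ(2)]])
    with IJ show "?h I \<subseteq> ?h J" by (intro closed_hull_subset closed_hull_in_closed_submodules)
  qed
  moreover have "?h (?h I) = ?h I" if "I \<in> nonzero_submodules" for I
    using that closed_hull_subset[OF closed_hull_in_closed_submodules[OF that] sub[OF that]]
      subset_closed_hull[OF sub[OF that]] by blast
  ultimately show ?thesis
    by (simp add: closure_operation_on_def subset_closed_hull)
qed

text \<open>Pull back along \<open>a\<close>: if \<open>J\<close> lies in \<open>dilate a K\<close>,
  then \<open>dilate (inverse a) J\<close> lies in \<open>K\<close>, and so does its image under
  \<open>c\<close>. That image is \<open>dilate (inverse a) (c J)\<close>, and multiplying by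
  \<open>a\<close> returns to \<open>dilate a K\<close>.\<close>

lemma dilate_closed_submodules:
  assumes dil: "\<And>a I. a \<noteq> 0 \<Longrightarrow> I \<in> \<M> \<Longrightarrow> dilate a I \<in> \<M>"
    and eqv: "\<And>a I. a \<noteq> 0 \<Longrightarrow> I \<in> \<M> \<Longrightarrow> c (dilate a I) = dilate a (c I)"
    and "a \<noteq> 0" "K \<in> closed_submodules \<M> c"
  shows "dilate a K \<in> closed_submodules \<M> c"
proof -
  have "c J \<subseteq> dilate a K" if "J \<in> \<M>" "J \<subseteq> dilate a K" for J
  proof -
    have "dilate (inverse a) J \<subseteq> K" "dilate (inverse a) J \<in> \<M>"
      using that dil \<open>a \<noteq> 0\<close> by (simp_all add: dilate_subset_iff)
    then have "c (dilate (inverse a) J) \<subseteq> K"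
      using assms(4) by (auto simp: closed_submodules_def)
    then show ?thesis
      using eqv[of "inverse a" J] that \<open>a \<noteq> 0\<close> by (simp add: dilate_subset_iff)
  qed
  then show ?thesis
    using assms(3,4) by (simp add: closed_submodules_def dilate_nonzero_submodule)
qed

lemma semistar_operation_closed_hull:
  assumes "\<And>a I. a \<noteq> 0 \<Longrightarrow> I \<in> \<M> \<Longrightarrow> dilate a I \<in> \<M>"
    and "\<And>a I. a \<noteq> 0 \<Longrightarrow> I \<in> \<M> \<Longrightarrow> c (dilate a I) = dilate a (c I)"
  shows "semistar_operation (closed_hull \<M> c)"
proof -
  let ?h = "closed_hull \<M> c"
  \<comment> \<open>Dividing the hull of \<open>dilate a I\<close> by \<open>a\<close> gives a
    closed submodule containing \<open>I\<close>, so it contains the hull of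
    \<open>I\<close>.\<close>
  have half: "dilate a (?h I) \<subseteq> ?h (dilate a I)"
    if "a \<noteq> 0" "I \<in> nonzero_submodules" for a I
  proof -
    have "dilate a I \<subseteq> ?h (dilate a I)"
      using that by (intro subset_closed_hull dilate_nonzero_submodule)
    moreover have "dilate (inverse a) (?h (dilate a I)) \<in> closed_submodules \<M> c"
      using that assms
      by (intro dilate_closed_submodules closed_hull_in_closed_submodules dilate_nonzero_submodule)
        simp_all
    ultimately show ?thesis
      using that by (simp add: dilate_subset_iff closed_hull_subset)
  qed
  have "?h (dilate a I) = dilate a (?h I)" if "a \<noteq> 0" "I \<in> nonzero_submodules" for a I
    using dilate_equivariantI[OF dilate_nonzero_submodule half that] .
  then show ?thesis
    using closure_operation_closed_hull by (auto simp: semistar_operation_def)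
qed

lemma closed_hull_extends:
  assumes "\<M> \<subseteq> nonzero_submodules" "closure_operation_on \<M> c" "I \<in> \<M>"
  shows "closed_hull \<M> c I = c I"
proof (rule antisym)
  have c: "c J \<in> \<M>" "J \<subseteq> c J" "c (c J) = c J" if "J \<in> \<M>" for J
    using assms(2) that by (auto simp: closure_operation_on_def)
  have mono: "mono_on \<M> c"
    using assms(2) by (simp add: closure_operation_on_def)
  \<comment> \<open>For \<open>J\<close> in \<open>\<M>\<close> below \<open>c I\<close>,
    monotonicity and idempotence give that \<open>c J\<close> lies in
    \<open>c (c I) = c I\<close>.\<close>
  have "c I \<in> closed_submodules \<M> c"
    using assms c mono_onD[OF mono, of _ "c I"] by (fastforce simp: closed_submodules_def)
  then show "closed_hull \<M> c I \<subseteq> c I"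
    using assms c by (intro closed_hull_subset) auto
  \<comment> \<open>Conversely, the hull is closed and contains \<open>I\<close>, which itself
    belongs to \<open>\<M>\<close>; testing closedness on \<open>I\<close> puts \<open>c I\<close>
    inside.\<close>
  have "I \<in> nonzero_submodules" using assms by blast
  then show "c I \<subseteq> closed_hull \<M> c I"
    using assms(3) closed_hull_in_closed_submodules[of I \<M> c] subset_closed_hull[of I \<M> c]
    by (auto simp: closed_submodules_def)
qed

lemma closed_hull_least:
  assumes "\<M> \<subseteq> nonzero_submodules" "semistar_extension \<M> c t" "I \<in> nonzero_submodules"
  shows "closed_hull \<M> c I \<subseteq> t I"
proof -
  have clo: "closure_operation_on nonzero_submodules t" and ext: "\<And>J. J \<in> \<M> \<Longrightarrow> t J = c J"
    using assms(2) by (auto simp: semistar_extension_def semistar_operation_def)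
  have t: "t J \<in> nonzero_submodules" "J \<subseteq> t J" "t (t J) = t J"
    if "J \<in> nonzero_submodules" for J
    using clo that by (auto simp: closure_operation_on_def)
  have mono: "mono_on nonzero_submodules t"
    using clo by (simp add: closure_operation_on_def)
  \<comment> \<open>Here \<open>c J = t J\<close> since \<open>t\<close> extends \<open>c\<close>,
    and \<open>t J\<close> lies in \<open>t (t I) = t I\<close>.\<close>
  have "c J \<subseteq> t I" if "J \<in> \<M>" "J \<subseteq> t I" for J
    using mono_onD[OF mono, of J "t I"] that assms(1,3) t ext by auto
  then have "t I \<in> closed_submodules \<M> c"
    using assms t by (simp add: closed_submodules_def)
  then show ?thesis
    using assms t by (intro closed_hull_subset)
qed

section \<open>Uniqueness and identification of the smallest extension\<close>

lemma smallest_semistar_extension_unique: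
  fixes s t :: "'a::idom fract set \<Rightarrow> 'a fract set"
  assumes "smallest_semistar_extension \<M> c s" "smallest_semistar_extension \<M> c t"
  shows "s = t"
proof (rule extensionalityI)
  \<comment> \<open>Minimality only compares values on nonzero submodules; elsewhere both maps take
    the same dummy value.\<close>
  show "s \<in> extensional nonzero_submodules" "t \<in> extensional nonzero_submodules"
    using assms by (auto simp: smallest_semistar_extension_def semistar_extension_def
        semistar_operation_def closure_operation_on_def PiE_def)
  fix I :: "'a fract set" assume "I \<in> nonzero_submodules"
  then show "s I = t I"
    using assms unfolding smallest_semistar_extension_def by blast
qed

text \<open>The hypotheses are what star operations and nuclei share. Characterizing
  \<open>s\<close> by an equation yields existence, uniqueness and the intersection formula
  together.\<close>

lemma smallest_semistar_extension_iff:
  assumes "\<M> \<subseteq> nonzero_submodules" "closure_operation_on \<M> c"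
    and "\<And>a I. a \<noteq> 0 \<Longrightarrow> I \<in> \<M> \<Longrightarrow> dilate a I \<in> \<M>"
    and "\<And>a I. a \<noteq> 0 \<Longrightarrow> I \<in> \<M> \<Longrightarrow> c (dilate a I) = dilate a (c I)"
  shows "smallest_semistar_extension \<M> c s \<longleftrightarrow> s = closed_hull \<M> c"
proof -
  have "smallest_semistar_extension \<M> c (closed_hull \<M> c)"
    using semistar_operation_closed_hull[OF assms(3,4)] closed_hull_extends[OF assms(1,2)]
      closed_hull_least[OF assms(1)]
    by (simp add: smallest_semistar_extension_def semistar_extension_def)
  then show ?thesis
    using smallest_semistar_extension_unique by blast
qed

section \<open>Nuclei on monoids containing the principal submodules\<close>

lemma submodule_product_dilate_base_domain:
  assumes "fract_module.subspace I"
  shows "submodule_product (dilate a base_domain) I = dilate a I"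
proof -
  \<comment> \<open>Elements of the base domain act as scalars and are absorbed by \<open>I\<close>,
    so the products already form a submodule and taking the span adds nothing.\<close>
  have "{x * y | x y. x \<in> dilate a base_domain \<and> y \<in> I} = dilate a I"
  proof (intro equalityI subsetI)
    fix z assume "z \<in> {x * y | x y. x \<in> dilate a base_domain \<and> y \<in> I}"
    then obtain d y where "y \<in> I" "z = a * to_fract d * y"
      unfolding dilate_def base_domain_def by blast
    then have "y \<in> I" "z = a * fract_scale d y"
      by (simp_all add: fract_scale_def mult.assoc)
    then show "z \<in> dilate a I"
      using fract_module.subspace_scale[OF assms] by (auto simp: dilate_def)
  next
    fix z assume "z \<in> dilate a I"
    then obtain y where "y \<in> I" "z = a * to_fract 1 * y" by (auto simp: dilate_def)
    then show "z \<in> {x * y | x y. x \<in> dilate a base_domain \<and> y \<in> I}"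
      unfolding dilate_def base_domain_def by blast
  qed
  then show ?thesis
    using subspace_dilate[OF assms] fract_module.span_eq_iff[of "dilate a I"]
    by (simp add: submodule_product_def)
qed

lemma mem_dilate_base_domain: "a \<in> dilate a base_domain"
  unfolding dilate_def base_domain_def
  by (metis image_eqI mult.right_neutral rangeI to_fract_1)

lemma
  fixes \<M> :: "'a::idom fract set set"
  assumes sub: "submonoid \<M> submodule_monoid" and prin: "principal_submodules \<subseteq> \<M>"
  shows submonoid_submodules_subset: "\<M> \<subseteq> nonzero_submodules"
    and submonoid_dilate_closed: "\<And>a I. a \<noteq> 0 \<Longrightarrow> I \<in> \<M> \<Longrightarrow> dilate a I \<in> \<M>"
proof -
  show *: "\<M> \<subseteq> nonzero_submodules"
    using submonoid.subset[OF sub] by (simp add: submodule_monoid_def)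
  fix a :: "'a fract" and I assume aI: "a \<noteq> 0" "I \<in> \<M>"
  \<comment> \<open>\<open>dilate a I\<close> is the product of a principal submodule and
    \<open>I\<close>, both members of \<open>\<M>\<close>.\<close>
  then have "submodule_product (dilate a base_domain) I \<in> \<M>"
    using submonoid.m_closed[OF sub, of "dilate a base_domain" I] prin
    by (auto simp: submodule_monoid_def principal_submodules_def)
  moreover have "fract_module.subspace I"
    using aI * by (auto simp: nonzero_submodules_def)
  ultimately show "dilate a I \<in> \<M>"
    by (simp add: submodule_product_dilate_base_domain)
qed

lemma nucleus_dilate:
  fixes c :: "'a::idom fract set \<Rightarrow> 'a fract set"
  assumes sub: "submonoid \<M> submodule_monoid" and prin: "principal_submodules \<subseteq> \<M>"
    and nuc: "nucleus (submodule_monoid\<lparr>carrier := \<M>\<rparr>) c"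
    and "a \<noteq> 0" "I \<in> \<M>"
  shows "c (dilate a I) = dilate a (c I)"
proof (rule dilate_equivariantI[OF submonoid_dilate_closed[OF sub prin] _ assms(4,5)])
  fix a :: "'a fract" and I assume aI: "a \<noteq> 0" "I \<in> \<M>"
  let ?D = "dilate a base_domain"
  have clo: "closure_operation_on \<M> c"
    and mult: "\<And>J K. J \<in> \<M> \<Longrightarrow> K \<in> \<M> \<Longrightarrow>
      submodule_product (c J) (c K) \<subseteq> c (submodule_product J K)"
    using nuc by (auto simp: nucleus_def submodule_monoid_def)
  have D: "?D \<in> \<M>" using prin aI by (auto simp: principal_submodules_def)
  have "fract_module.subspace I"
    using aI submonoid_submodules_subset[OF sub prin] by (auto simp: nonzero_submodules_def)
  then have prod: "submodule_product (c ?D) (c I) \<subseteq> c (dilate a I)"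
    using mult[OF D aI(2)] by (simp add: submodule_product_dilate_base_domain)
  \<comment> \<open>Expansiveness puts \<open>a\<close> into \<open>c ?D\<close>, so every
    \<open>a * x\<close> with \<open>x\<close> in \<open>c I\<close> is a generator of the product
    bounded in \<open>prod\<close>.\<close>
  have "a \<in> c ?D"
    using clo D mem_dilate_base_domain[of a] by (auto simp: closure_operation_on_def)
  then have "dilate a (c I) \<subseteq> submodule_product (c ?D) (c I)"
    unfolding dilate_def submodule_product_def by (auto intro!: fract_module.span_base)
  with prod show "dilate a (c I) \<subseteq> c (dilate a I)" by blast
qed

theorem proposition8p10:
  shows
    "(\<forall>st :: 'a::idom fract set \<Rightarrow> 'a fract set.
        star_operation st \<longrightarrow>
        (\<exists>!s. smallest_semistar_extension fractional_ideals st s) \<and>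
        (\<forall>s. smallest_semistar_extension fractional_ideals st s \<longrightarrow>
          (\<forall>I\<in>nonzero_submodules.
             s I = \<Inter>{K \<in> nonzero_submodules. I \<subseteq> K \<and>
                        (\<forall>J\<in>fractional_ideals. J \<subseteq> K \<longrightarrow> st J \<subseteq> K)})))
     \<and>
     (\<forall>(\<M> :: 'a fract set set) (\<gamma> :: 'a fract set \<Rightarrow> 'a fract set).
        submonoid \<M> submodule_monoid \<longrightarrow>
        principal_submodules \<subseteq> \<M> \<longrightarrow>
        nucleus (submodule_monoid\<lparr>carrier := \<M>\<rparr>) \<gamma> \<longrightarrow>
        (\<exists>!s. smallest_semistar_extension \<M> \<gamma> s) \<and>
        (\<forall>s. smallest_semistar_extension \<M> \<gamma> s \<longrightarrow>
          (\<forall>I\<in>nonzero_submodules.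
             s I = \<Inter>{K \<in> nonzero_submodules. I \<subseteq> K \<and>
                        (\<forall>J\<in>\<M>. J \<subseteq> K \<longrightarrow> \<gamma> J \<subseteq> K)})))"
proof -
  have hull: "(\<exists>!s. smallest_semistar_extension \<M> c s) \<and>
      (\<forall>s. smallest_semistar_extension \<M> c s \<longrightarrow>
        (\<forall>I\<in>nonzero_submodules.
           s I = \<Inter>{K \<in> nonzero_submodules. I \<subseteq> K \<and> (\<forall>J\<in>\<M>. J \<subseteq> K \<longrightarrow> c J \<subseteq> K)}))"
    if "\<M> \<subseteq> nonzero_submodules" "closure_operation_on \<M> c"
      and "\<And>a I. a \<noteq> 0 \<Longrightarrow> I \<in> \<M> \<Longrightarrow> dilate a I \<in> \<M>"
      and "\<And>a I. a \<noteq> 0 \<Longrightarrow> I \<in> \<M> \<Longrightarrow> c (dilate a I) = dilate a (c I)"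
    for \<M> and c :: "'a fract set \<Rightarrow> 'a fract set"
  proof -
    have "{K \<in> closed_submodules \<M> c. I \<subseteq> K} =
        {K \<in> nonzero_submodules. I \<subseteq> K \<and> (\<forall>J\<in>\<M>. J \<subseteq> K \<longrightarrow> c J \<subseteq> K)}" for I
      by (auto simp: closed_submodules_def)
    then show ?thesis
      by (simp add: smallest_semistar_extension_iff[OF that] closed_hull_eq)
  qed
  show ?thesis
    apply (rule conjI)
    \<comment> \<open>For a star operation, closure and equivariance belong to the definition;
      stability of fractional ideals under dilation is the remaining input.\<close>
    subgoal
      by (intro allI impI hull dilate_fractional_ideal)
        (auto simp: star_operation_def fractional_ideals_def)
    \<comment> \<open>For a nucleus, stability and equivariance are both derived from multiplication
      by principal submodules.\<close>
    subgoal
      by (intro allI impI hull)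
        (auto simp: submonoid_submodules_subset[THEN subsetD] submonoid_dilate_closed
          nucleus_dilate nucleus_def)
    done
qed

end
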